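(* Let $(A_m)_{m\ge 0}$ be a sequence of real numbers such that $\sum_{m\ge 0}\frac{A_m}{m!}x^m$ converges for every real $x$, and put $f(x)=e^{-x}\sum_{m=0}^{\infty}\frac{A_m}{m!}x^m$. Then for every $R>0$ and all integers $n\ge 0$, $N\ge0$, \[ A_n-\sum_{m=0}^{N}\frac{f^{(m)}(R)}{m!}R^mC_m(R,n)=\frac1{N!}\sum_{m=0}^{n-1}\frac{\Delta^{N+1}A_m}{m!}\int_R^\infty t^me^{-t}\,t^NC_N(t,n)\,dt-\frac1{N!}\sum_{m=n}^{\infty}\frac{\Delta^{N+1}A_m}{m!}\int_0^R t^me^{-t}\,t^NC_N(t,n)\,dt. \]
   Context: $\Delta A_m=A_{m+1}-A_m$, $\Delta^k$ its $k$-fold iterate. For real $t$ and integers $m,n\ge0$, $t^mC_m(t,n)$ denotes the polynomial $\sum_{j=0}^{m}(-1)^{m-j}\binom mj\,n(n-1)\cdots(n-j+1)\,t^{m-j}$; equivalently $t^mC_m(t,n)=n!\,[z^n]\bigl(e^z(z-t)^m\bigr)$, where $[z^n]$ denotes the coefficient of $z^n$ ($C_m$ are the Charlier polynomials). *)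

theory Defs
  imports "HOL-Analysis.Analysis"
begin

definition fwd_diff :: "(nat \<Rightarrow> real) \<Rightarrow> nat \<Rightarrow> real" where
  "fwd_diff A m = A (Suc m) - A m"

text \<open>
  The polynomial \<open>t^m C_m(t, n)\<close>, where \<open>C_m\<close> is the Charlier polynomial (which by itself
  has negative powers of \<open>t\<close>). The product is the falling factorial \<open>n (n - 1) ... (n - j + 1)\<close>.
\<close>

definition scaled_charlier :: "nat \<Rightarrow> real \<Rightarrow> nat \<Rightarrow> real" where
  "scaled_charlier m t n =
     (\<Sum>j\<le>m. (- 1) ^ (m - j) * real (m choose j) * (\<Prod>i<j. real n - real i) * t ^ (m - j))"

end

theory Submission
  imports Defs "HOL-Probability.Sinc_Integral"
begin

text \<open>
  The scaled Charlier polynomials satisfy \<open>P'\<^sub>m = - m P\<^sub>m\<^sub>-\<^sub>1\<close>, so the derivative of the partial sum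
  \<open>S(t) = \<Sum>m\<le>N. f\<^sup>(\<^sup>m\<^sup>)(t) P\<^sub>m(t) / m!\<close> telescopes to \<open>f\<^sup>(\<^sup>N\<^sup>+\<^sup>1\<^sup>)(t) P\<^sub>N(t) / N!\<close>. Integrating it
  over \<open>[0, R]\<close>, with \<open>f\<^sup>(\<^sup>N\<^sup>+\<^sup>1\<^sup>)\<close> expanded as \<open>e\<^sup>-\<^sup>t\<close> times a power series in the differences of
  \<open>A\<close>, gives \<open>S(R) - S(0)\<close>. At \<open>0\<close> the sum is Newton's interpolation formula, whose remainder is
  a sum over \<open>m < n\<close> with the weights \<open>(n - 1 - m) choose N\<close>; these are the moments
  \<open>\<integral> t\<^sup>m e\<^sup>-\<^sup>t P\<^sub>N(t) dt / (N! m!)\<close> over \<open>[0, \<infinity>)\<close>.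
\<close>

section \<open>Newton interpolation with remainder\<close>

lemma newton_remainder:
  "A (k + n) = (\<Sum>m\<le>N. real (n choose m) * (fwd_diff ^^ m) A k)
     + (\<Sum>m<n. real ((n - 1 - m) choose N) * (fwd_diff ^^ (N + 1)) A (k + m))"
proof (induction n arbitrary: k)
  case 0
  have "(\<Sum>m\<le>N. real (0 choose m) * (fwd_diff ^^ m) A k)
      = (\<Sum>m\<le>N. if m = 0 then A k else 0)"
    by (intro sum.cong) auto
  then show ?case by simp
next
  case (Suc n)
  let ?D = "\<lambda>m. (fwd_diff ^^ m) A"
  have shift: "?D m (Suc k) = ?D m k + ?D (Suc m) k" for m
    by (simp add: fwd_diff_def)
  \<comment> \<open>By \<open>shift\<close>, moving the base point from \<open>k\<close> to
    \<open>Suc k\<close> adds the next difference, and Pascal's rule raises \<open>n\<close> to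
    \<open>Suc n\<close>. At the cut-off the difference of order \<open>Suc N\<close> is left over;
    with weight \<open>n choose N\<close> it becomes the \<open>m = 0\<close> term of the new
    remainder.\<close>
  have pascal: "(\<Sum>m\<le>N. real (n choose m) * ?D m (Suc k))
      = (\<Sum>m\<le>N. real (Suc n choose m) * ?D m k) + real (n choose N) * ?D (Suc N) k"
  proof (induction N)
    case (Suc N)
    then show ?case by (simp add: shift algebra_simps del: funpow.simps)
  qed (simp add: fwd_diff_def)
  have "A (k + Suc n) = A (Suc k + n)" by simp
  also have "\<dots> = (\<Sum>m\<le>N. real (n choose m) * ?D m (Suc k))
      + (\<Sum>m<n. real ((n - 1 - m) choose N) * ?D (N + 1) (Suc k + m))"
    by (rule Suc.IH)
  also have "\<dots> = (\<Sum>m\<le>N. real (Suc n choose m) * ?D m k)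
      + (\<Sum>m<Suc n. real ((Suc n - 1 - m) choose N) * ?D (N + 1) (k + m))"
    using pascal by (subst sum.lessThan_Suc_shift) (simp del: funpow.simps)
  finally show ?case .
qed

section \<open>Scaled Charlier polynomials: value at 0, derivative, moments\<close>

lemma prod_falling_eq: "(\<Prod>i<j. real n - real i) = fact j * real (n choose j)"
  by (simp add: binomial_gbinomial gbinomial_prod_rev atLeast0LessThan)

lemma scaled_charlier_0_left [simp]: "scaled_charlier 0 t n = 1"
  by (simp add: scaled_charlier_def)

text \<open>Only \<open>j = m\<close> survives, as \<open>0 ^ (m - j)\<close> vanishes otherwise.
  After division by \<open>fact m\<close> this is the coefficient in Newton's formula.\<close>

lemma scaled_charlier_at_0: "scaled_charlier m 0 n = fact m * real (n choose m)"
proof -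
  have "scaled_charlier m 0 n = (\<Sum>j\<le>m. if j = m then fact m * real (n choose m) else 0)"
    unfolding scaled_charlier_def prod_falling_eq by (intro sum.cong) auto
  then show ?thesis by simp
qed

text \<open>Holds term by term, by the absorption identity (m + 1 - j) binom(m + 1, j) = (m + 1)
  binom(m, j); the top term \<open>j = Suc m\<close> is constant in \<open>t\<close>.\<close>

lemma DERIV_scaled_charlier:
  "((\<lambda>t. scaled_charlier (Suc m) t n) has_real_derivative
     - real (Suc m) * scaled_charlier m t n) (at t)"
proof -
  have "((\<lambda>t. scaled_charlier (Suc m) t n) has_real_derivative
     (\<Sum>j\<le>Suc m. (- 1) ^ (Suc m - j) * real (Suc m choose j) * (\<Prod>i<j. real n - real i)
        * (real (Suc m - j) * t ^ (Suc m - j - 1)))) (at t)"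
    unfolding scaled_charlier_def
    by (intro DERIV_sum DERIV_cmult) (auto intro!: derivative_eq_intros)
  also have "(\<Sum>j\<le>Suc m. (- 1) ^ (Suc m - j) * real (Suc m choose j) * (\<Prod>i<j. real n - real i)
        * (real (Suc m - j) * t ^ (Suc m - j - 1)))
      = (\<Sum>j\<le>m. (- 1) ^ (Suc m - j) * real (Suc m choose j) * (\<Prod>i<j. real n - real i)
        * (real (Suc m - j) * t ^ (Suc m - j - 1)))"
    by simp
  also have "\<dots> = - real (Suc m) * scaled_charlier m t n"
    unfolding scaled_charlier_def sum_distrib_left
  proof (rule sum.cong)
    fix j assume "j \<in> {..m}"
    then have [simp]: "Suc m - j = Suc (m - j)" by auto
    have "real ((Suc m - j) * (Suc m choose j)) = real (Suc m * (m choose j))"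
      by (subst binomial_absorb_comp) simp
    then have "real (Suc m choose j) * real (Suc (m - j)) = real (Suc m) * real (m choose j)"
      by (simp only: of_nat_mult \<open>Suc m - j = Suc (m - j)\<close> mult.commute)
    then have "real (Suc m choose j) * real (Suc (m - j)) * (- ((- 1) ^ (m - j)
          * (\<Prod>i<j. real n - real i) * t ^ (m - j)))
        = real (Suc m) * real (m choose j) * (- ((- 1) ^ (m - j)
          * (\<Prod>i<j. real n - real i) * t ^ (m - j)))"
      by simp
    then show "(- 1) ^ (Suc m - j) * real (Suc m choose j) * (\<Prod>i<j. real n - real i)
        * (real (Suc m - j) * t ^ (Suc m - j - 1))
      = - real (Suc m) * ((- 1) ^ (m - j) * real (m choose j) * (\<Prod>i<j. real n - real i)
        * t ^ (m - j))"
      by (simp add: mult_ac del: of_nat_Suc)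
  qed simp
  finally show ?thesis .
qed

lemma continuous_on_scaled_charlier [continuous_intros]:
  "continuous_on S (\<lambda>t. scaled_charlier m t n)"
  unfolding scaled_charlier_def by (intro continuous_intros)

text \<open>Each power of \<open>t\<close> contributes a Gamma integral
  \<open>fact (m + (N - j))\<close>. The resulting alternating sum is a Vandermonde convolution with
  upper arguments n and -(m + 1).\<close>

lemma charlier_moment:
  shows charlier_moment_integrable:
      "set_integrable lborel {0..} (\<lambda>t. t ^ m * exp (- t) * scaled_charlier N t n)" (is ?int)
    and charlier_moment_eq: "m < n \<Longrightarrow>
      (LBINT t:{0..}. t ^ m * exp (- t) * scaled_charlier N t n)
        = fact N * fact m * real ((n - 1 - m) choose N)" (is "_ \<Longrightarrow> ?eq")
proof -
  let ?c = "\<lambda>j. (- 1) ^ (N - j) * real (N choose j) * (\<Prod>i<j. real n - real i)"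
  have "has_bochner_integral lborel
      (\<lambda>t. \<Sum>j\<le>N. ?c j * (t ^ (m + (N - j)) * exp (- t) * indicator {0..} t))
      (\<Sum>j\<le>N. ?c j * fact (m + (N - j)))"
    by (intro has_bochner_integral_sum has_bochner_integral_mult_right
          has_bochner_integral_I0i_power_exp_m')
  also have "(\<lambda>t. \<Sum>j\<le>N. ?c j * (t ^ (m + (N - j)) * exp (- t) * indicator {0..} t))
      = (\<lambda>t. indicator {0..} t *\<^sub>R (t ^ m * exp (- t) * scaled_charlier N t n))"
    by (simp add: scaled_charlier_def sum_distrib_left sum_distrib_right power_add mult_ac
        del: Nat.add_diff_assoc)
  finally have *: "has_bochner_integral lborel
      (\<lambda>t. indicator {0..} t *\<^sub>R (t ^ m * exp (- t) * scaled_charlier N t n))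
      (\<Sum>j\<le>N. ?c j * fact (m + (N - j)))" .
  then show ?int
    by (auto simp: set_integrable_def has_bochner_integral_iff)
  assume "m < n"
  have "?c j * fact (m + (N - j)) = fact N * fact m *
      ((real n gchoose j) * ((- (real m + 1)) gchoose (N - j)))" if "j \<le> N" for j
  proof -
    obtain d where N: "N = j + d" using \<open>j \<le> N\<close> le_Suc_ex by blast
    \<comment> \<open>Negating the upper argument absorbs the sign \<open>(- 1) ^ (N - j)\<close>
      into the second binomial.\<close>
    have "real ((m + d) choose d) = (- 1) ^ d * ((- (real m + 1)) gchoose d)"
      using gbinomial_minus'[of "real m" d] by (simp add: binomial_gbinomial)
    then have "(- (real m + 1)) gchoose d = (- 1) ^ d * real ((m + d) choose d)"
      by (simp flip: mult.assoc power_mult_distrib)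
    then show ?thesis
      by (simp add: N prod_falling_eq binomial_fact[of j "d + j"] binomial_fact[of d "d + m"]
          field_simps binomial_gbinomial[of n, symmetric])
  qed
  then have "(\<Sum>j\<le>N. ?c j * fact (m + (N - j))) = fact N * fact m *
      (\<Sum>j\<le>N. (real n gchoose j) * ((- (real m + 1)) gchoose (N - j)))"
    by (simp add: sum_distrib_left)
  also have "(\<Sum>j\<le>N. (real n gchoose j) * ((- (real m + 1)) gchoose (N - j)))
      = (real n + - (real m + 1)) gchoose N"
    by (simp only: gbinomial_Vandermonde flip: atLeast0AtMost)
  \<comment> \<open>For \<open>m < n\<close> the natural subtraction is not truncated; for
    \<open>m >= n\<close> the left side would be negative.\<close>
  also have "real n + - (real m + 1) = real (n - 1 - m)"
    using \<open>m < n\<close> by (simp add: of_nat_diff)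
  finally show ?eq
    using * by (simp add: set_lebesgue_integral_def has_bochner_integral_iff binomial_gbinomial)
qed

section \<open>Exponential generating functions and forward differences\<close>

definition egf :: "(nat \<Rightarrow> real) \<Rightarrow> real \<Rightarrow> real" where
  "egf A x = (\<Sum>m. A m / fact m * x ^ m)"

lemma egf_0 [simp]: "egf A 0 = A 0"
  using powser_zero[of "\<lambda>m. A m / fact m"] by (simp add: egf_def mult_ac)

lemma diffs_egf: "diffs (\<lambda>m. A m / fact m) = (\<lambda>m. A (Suc m) / fact m :: real)"
  by (simp add: diffs_def fun_eq_iff field_simps del: of_nat_Suc)

context
  fixes A :: "nat \<Rightarrow> real"
  assumes summable_egf: "\<And>x. summable (\<lambda>m. A m / fact m * x ^ m)"
begin

lemma summable_egf_Suc: "summable (\<lambda>m. A (Suc m) / fact m * x ^ m)"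
  using termdiff_converges_all[OF summable_egf] by (simp add: diffs_egf)

lemma summable_egf_fwd_diff: "summable (\<lambda>m. fwd_diff A m / fact m * x ^ m)"
  using summable_diff[OF summable_egf_Suc summable_egf, of x x]
  by (simp add: fwd_diff_def diff_divide_distrib left_diff_distrib)

text \<open>Differentiating \<open>egf A\<close> shifts the sequence by one, and the factor
  \<open>exp (- x)\<close> subtracts the unshifted series. So differentiation acts on the
  coefficients as \<open>fwd_diff\<close>.\<close>

lemma DERIV_exp_egf:
  "((\<lambda>x. exp (- x) * egf A x) has_real_derivative exp (- x) * egf (fwd_diff A) x) (at x)"
proof -
  have "egf (fwd_diff A) x = (\<Sum>m. A (Suc m) / fact m * x ^ m) - egf A x"
    unfolding egf_def
    by (subst suminf_diff[OF summable_egf_Suc summable_egf])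
       (simp add: fwd_diff_def diff_divide_distrib left_diff_distrib)
  then have "(egf A has_real_derivative egf A x + egf (fwd_diff A) x) (at x)"
    unfolding egf_def[of A, abs_def]
    using termdiffs_strong_converges_everywhere[OF summable_egf, of x]
    by (simp add: diffs_egf egf_def)
  then show ?thesis
    by (auto intro!: derivative_eq_intros simp: algebra_simps)
qed

end

lemma summable_egf_funpow:
  assumes "\<And>x. summable (\<lambda>m. A m / fact m * x ^ m :: real)"
  shows "summable (\<lambda>m. (fwd_diff ^^ k) A m / fact m * x ^ m)"
proof (induction k arbitrary: x)
  case (Suc k)
  show ?case
    using summable_egf_fwd_diff[OF Suc.IH] by simp
qed (simp only: funpow_0 assms)

lemma funpow_deriv_exp_egf:
  assumes "\<And>x. summable (\<lambda>m. A m / fact m * x ^ m :: real)"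
  shows "(deriv ^^ k) (\<lambda>x. exp (- x) * egf A x) = (\<lambda>x. exp (- x) * egf ((fwd_diff ^^ k) A) x)"
proof (induction k)
  case (Suc k)
  show ?case
    by (simp add: Suc.IH fun_eq_iff DERIV_imp_deriv[OF DERIV_exp_egf[OF summable_egf_funpow[OF assms]]])
qed simp

lemma continuous_on_exp_egf:
  assumes "\<And>x. summable (\<lambda>m. A m / fact m * x ^ m :: real)"
  shows "continuous_on S (\<lambda>x. exp (- x) * egf A x)"
  by (rule DERIV_continuous_on, rule has_field_derivative_at_within, rule DERIV_exp_egf[OF assms])

section \<open>Telescoping derivative and termwise integration\<close>

lemma DERIV_charlier_partial_sum:
  fixes g :: "nat \<Rightarrow> real \<Rightarrow> real"
  assumes g: "\<And>m. (g m has_real_derivative g (Suc m) t) (at t)"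
  shows "((\<lambda>t. \<Sum>m\<le>N. g m t / fact m * scaled_charlier m t n) has_real_derivative
    g (Suc N) t * scaled_charlier N t n / fact N) (at t)"
proof (induction N)
  case 0
  show ?case using g[of 0] by simp
next
  case (Suc N)
  \<comment> \<open>Differentiating the polynomial in the new term gives
    \<open>- g (Suc N) t * scaled_charlier N t n / fact N\<close>, which cancels the induction
    hypothesis; differentiating \<open>g (Suc N)\<close> gives the claim.\<close>
  show ?case
    unfolding sum.atMost_Suc
    by (rule derivative_eq_intros Suc DERIV_cdivide[OF g] DERIV_scaled_charlier refl)+
       (simp add: field_simps del: of_nat_Suc)
qed

text \<open>Sum and integral may be exchanged because on [0, R] the \<open>m\<close>-th term is
  dominated by \<open>\<bar>A m / fact m * R ^ m\<bar> * M\<close>, with \<open>M\<close> a bound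
  for \<open>exp (- t) * p t\<close>, and the power series converges absolutely at
  \<open>R\<close>.\<close>

lemma sums_integral_exp_egf:
  fixes p :: "real \<Rightarrow> real"
  assumes summable: "\<And>x. summable (\<lambda>m. A m / fact m * x ^ m)"
    and p: "continuous_on {0..R} p" and "R \<ge> 0"
  shows "(\<lambda>m. A m / fact m * (LBINT t:{0..R}. t ^ m * exp (- t) * p t)) sums
    (LBINT t:{0..R}. exp (- t) * egf A t * p t)"
proof -
  let ?h = "\<lambda>m t. indicator {0..R} t *\<^sub>R (A m / fact m * (t ^ m * exp (- t) * p t))"
  have "compact ((\<lambda>t. exp (- t) * p t) ` {0..R})"
    by (intro compact_continuous_image continuous_intros p compact_Icc)
  then have "bounded ((\<lambda>t. exp (- t) * p t) ` {0..R})"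
    by (rule compact_imp_bounded)
  then obtain M where M: "\<bar>exp (- t) * p t\<bar> \<le> M" if "t \<in> {0..R}" for t
    unfolding bounded_iff ball_simps real_norm_def by blast
  have [simp]: "0 \<le> M" using M[of 0] \<open>R \<ge> 0\<close> by (smt (verit) atLeastAtMost_iff)
  have bound: "norm (?h m t) \<le> indicator {0..R} t *\<^sub>R (\<bar>A m / fact m * R ^ m\<bar> * M)" for m t
  proof (cases "t \<in> {0..R}")
    case True
    then have "\<bar>A m / fact m\<bar> * \<bar>t ^ m\<bar> * \<bar>exp (- t) * p t\<bar> \<le> \<bar>A m / fact m\<bar> * \<bar>R ^ m\<bar> * M"
      by (intro mult_mono M) (auto intro: power_mono)
    with True show ?thesis by (simp add: abs_mult mult_ac)
  qed simp
  have int: "integrable lborel (?h m)" for m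
    using borel_integrable_atLeastAtMost'[of 0 R "\<lambda>t. A m / fact m * (t ^ m * exp (- t) * p t)"] p
    by (simp add: set_integrable_def continuous_intros)
  have intc: "integrable lborel (\<lambda>t. indicator {0..R} t *\<^sub>R c)" for c :: real
    using borel_integrable_atLeastAtMost'[of 0 R "\<lambda>_. c"] by (simp add: set_integrable_def)
  \<comment> \<open>Convergence at a point farther from 0 than \<open>x\<close> forces absolute
    convergence at \<open>x\<close>.\<close>
  have abs: "summable (\<lambda>m. \<bar>A m / fact m * x ^ m\<bar>)" for x
    using powser_insidea[OF summable[of "\<bar>x\<bar> + 1"], of x] by simp
  have sums: "(\<lambda>m. ?h m t) sums (indicator {0..R} t *\<^sub>R (exp (- t) * egf A t * p t))" for t
    using sums_mult2[OF summable_sums[OF summable[of t]], of "indicator {0..R} t * (exp (- t) * p t)"]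
    by (simp add: egf_def mult_ac)
  have "(\<lambda>m. integral\<^sup>L lborel (?h m)) sums (\<integral>t. (\<Sum>m. ?h m t) \<partial>lborel)"
  proof (rule sums_integral[OF int])
    show "AE t in lborel. summable (\<lambda>m. norm (?h m t))"
    proof (rule AE_I2)
      fix t :: real
      show "summable (\<lambda>m. norm (?h m t))"
        by (rule summable_comparison_test'[OF summable_mult[OF summable_mult2[OF abs[of R], of M]]])
           (use bound in auto)
    qed
    show "summable (\<lambda>m. \<integral>t. norm (?h m t) \<partial>lborel)"
    proof (rule summable_comparison_test'[OF summable_mult[OF summable_mult2[OF abs[of R], of M]]])
      fix m
      have "(\<integral>t. norm (?h m t) \<partial>lborel)
          \<le> (\<integral>t. indicator {0..R} t *\<^sub>R (\<bar>A m / fact m * R ^ m\<bar> * M) \<partial>lborel)"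
        by (intro integral_mono bound integrable_norm int intc)
      also have "\<dots> = R * (\<bar>A m / fact m * R ^ m\<bar> * M)"
        using \<open>R \<ge> 0\<close> by simp
      finally show "norm (\<integral>t. norm (?h m t) \<partial>lborel) \<le> R * (\<bar>A m / fact m * R ^ m\<bar> * M)"
        by simp
    qed
  qed
  also have "(\<lambda>t. \<Sum>m. ?h m t) = (\<lambda>t. indicator {0..R} t *\<^sub>R (exp (- t) * egf A t * p t))"
    using sums by (auto simp: sums_iff)
  also have "(\<lambda>m. integral\<^sup>L lborel (?h m))
      = (\<lambda>m. A m / fact m * (LBINT t:{0..R}. t ^ m * exp (- t) * p t))"
    by (simp only: set_lebesgue_integral_def[symmetric] set_integral_mult_right)
  finally show ?thesis by (simp only: set_lebesgue_integral_def)
qed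

text \<open>As \<open>suminf\<close> is a total function, the first conjunct certifies that the
  series over \<open>m >= n\<close>, reindexed as \<open>n + k\<close>, really converges.\<close>

theorem theorem8:
  fixes A :: "nat \<Rightarrow> real" and f :: "real \<Rightarrow> real" and R :: real and n N :: nat
  assumes "\<And>x::real. summable (\<lambda>m. A m / fact m * x ^ m)"
    and "\<And>x. f x = exp (- x) * (\<Sum>m. A m / fact m * x ^ m)"
    and "R > 0"
  shows "summable (\<lambda>k. (fwd_diff ^^ (N + 1)) A (n + k) / fact (n + k)
             * (LBINT t:{0..R}. t ^ (n + k) * exp (- t) * scaled_charlier N t n))
       \<and> A n - (\<Sum>m\<le>N. (deriv ^^ m) f R / fact m * scaled_charlier m R n)
         = 1 / fact N * (\<Sum>m<n. (fwd_diff ^^ (N + 1)) A m / fact m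
             * (LBINT t:{R..}. t ^ m * exp (- t) * scaled_charlier N t n))
         - 1 / fact N * (\<Sum>k. (fwd_diff ^^ (N + 1)) A (n + k) / fact (n + k)
             * (LBINT t:{0..R}. t ^ (n + k) * exp (- t) * scaled_charlier N t n))"
proof -
  note [simp del] = funpow.simps
  define B where "B = (fwd_diff ^^ (N + 1)) A"
  define g where "g m x = exp (- x) * egf ((fwd_diff ^^ m) A) x" for m x
  define S where "S t = (\<Sum>m\<le>N. g m t / fact m * scaled_charlier m t n)" for t
  define I where "I m = (LBINT t:{0..R}. t ^ m * exp (- t) * scaled_charlier N t n)" for m
  define J where "J m = (LBINT t:{R..}. t ^ m * exp (- t) * scaled_charlier N t n)" for m
  note summable = summable_egf_funpow[of A, OF assms(1)]
  have f_eq: "f = (\<lambda>x. exp (- x) * egf A x)"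
    using assms(2) by (simp add: egf_def fun_eq_iff)
  have deriv_f: "(deriv ^^ m) f = g m" for m
    unfolding f_eq g_def[abs_def] by (rule funpow_deriv_exp_egf[OF assms(1)])
  have DERIV_g: "(g m has_real_derivative g (Suc m) t) (at t)" for m t
    using DERIV_exp_egf[OF summable, of m t] by (simp add: g_def[abs_def] funpow.simps)
  have I_sums: "(\<lambda>m. B m / fact m * I m) sums
      (LBINT t:{0..R}. exp (- t) * egf B t * scaled_charlier N t n)"
    unfolding B_def I_def using \<open>R > 0\<close>
    by (intro sums_integral_exp_egf summable continuous_intros) auto
  \<comment> \<open>Since \<open>g (Suc N) t = exp (- t) * egf B t\<close>, the fundamental theorem
    of calculus reduces the difference to the integral evaluated in \<open>I_sums\<close>.\<close>
  have "S R - S 0 = (LBINT t:{0..R}. g (Suc N) t * scaled_charlier N t n / fact N)"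
    unfolding set_lebesgue_integral_def
  proof (rule integral_FTC_atLeastAtMost[symmetric])
    show "(S has_vector_derivative g (Suc N) t * scaled_charlier N t n / fact N) (at t within {0..R})" for t
      unfolding S_def[abs_def] has_real_derivative_iff_has_vector_derivative[symmetric]
      by (intro DERIV_subset[OF DERIV_charlier_partial_sum] DERIV_g) auto
    have "continuous_on {0..R} (g (Suc N))"
      unfolding g_def[abs_def] by (intro continuous_on_exp_egf summable)
    then show "continuous_on {0..R} (\<lambda>t. g (Suc N) t * scaled_charlier N t n / fact N)"
      by (intro continuous_intros) auto
  qed (use \<open>R > 0\<close> in simp)
  also have "\<dots> = (\<Sum>m. B m / fact m * I m) / fact N"
    using I_sums by (simp add: sums_iff g_def B_def)
  finally have S_diff: "S R - S 0 = (\<Sum>m. B m / fact m * I m) / fact N" .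
  have S_0: "S 0 = (\<Sum>m\<le>N. real (n choose m) * (fwd_diff ^^ m) A 0)"
    by (simp add: S_def g_def scaled_charlier_at_0 mult_ac)
  \<comment> \<open>The two ranges overlap only in the null set {R}, so the sum is the full moment;
    this turns the weights of Newton's remainder into integrals.\<close>
  have IJ: "I m + J m = fact N * fact m * real ((n - 1 - m) choose N)" if "m < n" for m
  proof -
    let ?p = "\<lambda>t. t ^ m * exp (- t) * scaled_charlier N t n"
    have "set_integrable lborel {0..} ?p" by (rule charlier_moment_integrable)
    then have "I m + J m = (LBINT t:{0..R} \<union> {R..}. ?p t)"
      unfolding I_def J_def using \<open>R > 0\<close> AE_lborel_singleton[of R]
      by (intro set_integral_Un_AE[symmetric]) (auto elim!: set_integrable_subset eventually_mono)
    also have "{0..R} \<union> {R..} = {0..}" using \<open>R > 0\<close> by auto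
    finally show ?thesis using charlier_moment_eq[OF that] by simp
  qed
  have "A n = S 0 + (\<Sum>m<n. real ((n - 1 - m) choose N) * B m)"
    using newton_remainder[of A 0 n N] by (simp add: S_0 B_def)
  also have "(\<Sum>m<n. real ((n - 1 - m) choose N) * B m)
      = (\<Sum>m<n. B m / fact m * (I m + J m)) / fact N"
    by (simp add: IJ sum_divide_distrib mult_ac)
  also have "\<dots> = (\<Sum>m<n. B m / fact m * I m) / fact N + (\<Sum>m<n. B m / fact m * J m) / fact N"
    by (simp add: distrib_left sum.distrib add_divide_distrib)
  finally have "A n = S 0 + ((\<Sum>m<n. B m / fact m * I m) / fact N
      + (\<Sum>m<n. B m / fact m * J m) / fact N)" .
  \<comment> \<open>The initial segment \<open>m < n\<close> of the series for
    \<open>S R - S 0\<close> cancels the \<open>I\<close> part of Newton's remainder. What remains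
    is \<open>J m\<close> for \<open>m < n\<close> and \<open>I m\<close> for
    \<open>m >= n\<close>.\<close>
  moreover have "(\<Sum>m. B m / fact m * I m)
      = (\<Sum>k. B (n + k) / fact (n + k) * I (n + k)) + (\<Sum>m<n. B m / fact m * I m)"
    using suminf_split_initial_segment[OF sums_summable[OF I_sums], of n] by (simp add: add.commute)
  ultimately have "A n - S R = 1 / fact N * (\<Sum>m<n. B m / fact m * J m)
      - 1 / fact N * (\<Sum>k. B (n + k) / fact (n + k) * I (n + k))"
    using S_diff by (simp add: add_divide_distrib)
  moreover have "summable (\<lambda>k. B (n + k) / fact (n + k) * I (n + k))"
    using summable_ignore_initial_segment[OF sums_summable[OF I_sums], of n] by (simp add: add.commute)
  ultimately show ?thesis
    unfolding deriv_f B_def I_def J_def S_def by blast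
qed

end
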